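(* Let $\mathcal{D}$ and $\mathcal{E}$ be real vector spaces. If $\varsigma:\mathcal{D}\to\mathcal{E}$ is a mapping satisfying \begin{align*} &\varsigma(u+13v)-25\varsigma(u+12v)+300\varsigma(u+11v)-2300\varsigma(u+10v)+12650\varsigma(u+9v)\\ &-53130\varsigma(u+8v)+177100\varsigma(u+7v)-480700\varsigma(u+6v)+1081575\varsigma(u+5v)\\ &-2042975\varsigma(u+4v)+3268760\varsigma(u+3v)-4457400\varsigma(u+2v)+5200300\varsigma(u+v)\\ &-5200300\varsigma(u)+4457400\varsigma(u-v)-3268760\varsigma(u-2v)+2042975\varsigma(u-3v)\\ &-1081575\varsigma(u-4v)+480700\varsigma(u-5v)-177100\varsigma(u-6v)+53130\varsigma(u-7v)\\ &-12650\varsigma(u-8v)+2300\varsigma(u-9v)-300\varsigma(u-10v)+25\varsigma(u-11v)-\varsigma(u-12v)=25!\,\varsigma(v) \end{align*} for all $u,v\in\mathcal{D}$, then $\varsigma(2u)=2^{25}\varsigma(u)$ for all $u\in\mathcal{D}$. *)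

theory Defs
  imports Complex_Main
begin

end

theory Submission
  imports Defs
begin

text \<open>
  The hypothesis says that the 25th forward difference of \<open>\<sigma>\<close> with step \<open>v\<close> is constantly
  \<open>25! \<sigma>(v)\<close>. Writing \<open>E\<close> for the shift by \<open>v\<close>, the difference with step \<open>2v\<close> factors as
  \<open>E^2 - 1 = (E + 1)(E - 1)\<close>, and \<open>E + 1\<close> doubles constants. Hence the 25th difference with step
  \<open>2v\<close>, which is \<open>25! \<sigma>(2v)\<close>, equals \<open>2^25 25! \<sigma>(v)\<close>.
\<close>

definition fdiff :: "'a::ab_group_add \<Rightarrow> ('a \<Rightarrow> 'b::ab_group_add) \<Rightarrow> 'a \<Rightarrow> 'b"
  where "fdiff h f x = f (x + h) - f x"

text \<open>Iterated differences are additive and commute with translation, so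
  \<open>(E - 1)^n\<close> passes through the factor \<open>E + 1\<close>.\<close>

lemma fdiff_funpow_shift_add:
  "(fdiff h ^^ n) (\<lambda>x. g (x + h) + g x) = (\<lambda>x. (fdiff h ^^ n) g (x + h) + (fdiff h ^^ n) g x)"
  by (induction n) (auto simp: fdiff_def)

text \<open>Each induction step peels off one factor \<open>E^2 - 1 = (E + 1)(E - 1)\<close> and
  doubles the constant, so \<open>c\<close> must be generalized along with \<open>f\<close>.\<close>

lemma fdiff_funpow_double_step:
  fixes f :: "'a::ab_group_add \<Rightarrow> 'b::real_vector"
  assumes "(fdiff h ^^ n) f = (\<lambda>_. c)"
  shows "(fdiff (h + h) ^^ n) f = (\<lambda>_. 2 ^ n *\<^sub>R c)"
  using assms
proof (induction n arbitrary: f c)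
  case 0
  then show ?case by simp
next
  case (Suc n)
  let ?g = "fdiff h f"
  have "(fdiff h ^^ n) ?g = (\<lambda>_. c)"
    using Suc.prems by (simp only: funpow_Suc_right o_apply)
  moreover have "fdiff (h + h) f = (\<lambda>x. ?g (x + h) + ?g x)"
    by (simp add: fdiff_def fun_eq_iff add.assoc)
  ultimately have "(fdiff h ^^ n) (fdiff (h + h) f) = (\<lambda>_. 2 *\<^sub>R c)"
    by (simp add: fdiff_funpow_shift_add scaleR_2)
  from Suc.IH[OF this] show ?case
    by (simp only: funpow_Suc_right o_apply scaleR_scaleR power_Suc2)
qed

text \<open>Binomial expansion of \<open>(E - 1)^n\<close>. The sign is written with
  \<open>n + k\<close>, which has the same parity as \<open>n - k\<close> and avoids truncated
  subtraction.\<close>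

lemma fdiff_funpow_eq_sum:
  fixes f :: "'a::real_vector \<Rightarrow> 'b::real_vector"
  shows "(fdiff h ^^ n) f x =
    (\<Sum>k\<le>n. ((-1) ^ (n + k) * real (n choose k)) *\<^sub>R f (x + real k *\<^sub>R h))"
proof (induction n arbitrary: x)
  case 0
  then show ?case by simp
next
  case (Suc n)
  let ?a = "\<lambda>k. f (x + real k *\<^sub>R h)"
  let ?A = "\<Sum>k\<le>n. ((-1) ^ (n + k) * real (n choose k)) *\<^sub>R ?a (Suc k)"
  let ?B = "\<Sum>k\<le>n. ((-1) ^ (n + k) * real (n choose Suc k)) *\<^sub>R ?a (Suc k)"
  \<comment> \<open>The added term vanishes because \<open>n choose Suc n = 0\<close>. Splitting off
    \<open>k = 0\<close> then leaves a sum over the same nodes as \<open>?A\<close>.\<close>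
  have "(fdiff h ^^ n) f x = (\<Sum>k\<le>Suc n. ((-1) ^ (n + k) * real (n choose k)) *\<^sub>R ?a k)"
    by (simp add: Suc.IH)
  also have "\<dots> = (-1) ^ n *\<^sub>R f x - ?B"
    by (subst sum.atMost_Suc_shift) (simp add: sum_negf del: of_nat_Suc)
  finally have "(fdiff h ^^ n) f x = (-1) ^ n *\<^sub>R f x - ?B" .
  moreover have "(fdiff h ^^ n) f (x + h) = ?A"
    by (simp add: Suc.IH scaleR_left_distrib add.assoc)
  ultimately have "(fdiff h ^^ Suc n) f x = - ((-1) ^ n *\<^sub>R f x) + (?A + ?B)"
    by (simp add: fdiff_def del: of_nat_Suc)
  \<comment> \<open>Pascal's rule merges \<open>?A\<close> and \<open>?B\<close>; the signs agree
    since \<open>Suc n + Suc k\<close> and \<open>n + k\<close> have equal parity.\<close>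
  also have "\<dots> = (\<Sum>k\<le>Suc n. ((-1) ^ (Suc n + k) * real (Suc n choose k)) *\<^sub>R ?a k)"
    by (subst sum.atMost_Suc_shift)
       (simp add: sum.distrib scaleR_left_distrib ring_distribs del: of_nat_Suc)
  finally show ?case .
qed

lemma choose_25:
  "25 choose 2 = (300::nat)"
  "25 choose 3 = (2300::nat)"
  "25 choose 4 = (12650::nat)"
  "25 choose 5 = (53130::nat)"
  "25 choose 6 = (177100::nat)"
  "25 choose 7 = (480700::nat)"
  "25 choose 8 = (1081575::nat)"
  "25 choose 9 = (2042975::nat)"
  "25 choose 10 = (3268760::nat)"
  "25 choose 11 = (4457400::nat)"
  "25 choose 12 = (5200300::nat)"
  "25 choose 13 = (5200300::nat)"
  "25 choose 14 = (4457400::nat)"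
  "25 choose 15 = (3268760::nat)"
  "25 choose 16 = (2042975::nat)"
  "25 choose 17 = (1081575::nat)"
  "25 choose 18 = (480700::nat)"
  "25 choose 19 = (177100::nat)"
  "25 choose 20 = (53130::nat)"
  "25 choose 21 = (12650::nat)"
  "25 choose 22 = (2300::nat)"
  "25 choose 23 = (300::nat)"
  "25 choose 24 = (25::nat)"
  by (simp_all add: binomial_fact' fact_numeral)

theorem theorem2p1:
  fixes \<sigma> :: "'d::real_vector \<Rightarrow> 'e::real_vector"
  assumes "\<And>u v.
      \<sigma> (u + 13 *\<^sub>R v)
      - 25 *\<^sub>R \<sigma> (u + 12 *\<^sub>R v)
      + 300 *\<^sub>R \<sigma> (u + 11 *\<^sub>R v)
      - 2300 *\<^sub>R \<sigma> (u + 10 *\<^sub>R v)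
      + 12650 *\<^sub>R \<sigma> (u + 9 *\<^sub>R v)
      - 53130 *\<^sub>R \<sigma> (u + 8 *\<^sub>R v)
      + 177100 *\<^sub>R \<sigma> (u + 7 *\<^sub>R v)
      - 480700 *\<^sub>R \<sigma> (u + 6 *\<^sub>R v)
      + 1081575 *\<^sub>R \<sigma> (u + 5 *\<^sub>R v)
      - 2042975 *\<^sub>R \<sigma> (u + 4 *\<^sub>R v)
      + 3268760 *\<^sub>R \<sigma> (u + 3 *\<^sub>R v)
      - 4457400 *\<^sub>R \<sigma> (u + 2 *\<^sub>R v)
      + 5200300 *\<^sub>R \<sigma> (u + v)
      - 5200300 *\<^sub>R \<sigma> u
      + 4457400 *\<^sub>R \<sigma> (u - v)
      - 3268760 *\<^sub>R \<sigma> (u - 2 *\<^sub>R v)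
      + 2042975 *\<^sub>R \<sigma> (u - 3 *\<^sub>R v)
      - 1081575 *\<^sub>R \<sigma> (u - 4 *\<^sub>R v)
      + 480700 *\<^sub>R \<sigma> (u - 5 *\<^sub>R v)
      - 177100 *\<^sub>R \<sigma> (u - 6 *\<^sub>R v)
      + 53130 *\<^sub>R \<sigma> (u - 7 *\<^sub>R v)
      - 12650 *\<^sub>R \<sigma> (u - 8 *\<^sub>R v)
      + 2300 *\<^sub>R \<sigma> (u - 9 *\<^sub>R v)
      - 300 *\<^sub>R \<sigma> (u - 10 *\<^sub>R v)
      + 25 *\<^sub>R \<sigma> (u - 11 *\<^sub>R v)
      - \<sigma> (u - 12 *\<^sub>R v)
      = fact 25 *\<^sub>R \<sigma> v"
  shows "\<forall>u. \<sigma> (2 *\<^sub>R u) = 2 ^ 25 *\<^sub>R \<sigma> u"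
proof
  fix v :: 'd
  \<comment> \<open>The inner \<open>v\<close> shadows the fixed one: the fact is needed for the
    steps \<open>v\<close> and \<open>v + v\<close>.\<close>
  have diff: "(fdiff v ^^ 25) \<sigma> = (\<lambda>_. fact 25 *\<^sub>R \<sigma> v)" for v
  proof
    fix u
    \<comment> \<open>The hypothesis has nodes from \<open>u - 12 v\<close> to
      \<open>u + 13 v\<close>. Replacing \<open>u\<close> by \<open>u + 12 v\<close> moves them to
      \<open>u + k v\<close> with \<open>k\<close> from 0 to 25, as in the expanded
      difference.\<close>
    have shift [simp]: "u + 12 *\<^sub>R v + a *\<^sub>R v = u + (12 + a) *\<^sub>R v"
      "u + 12 *\<^sub>R v - a *\<^sub>R v = u + (12 - a) *\<^sub>R v" for a
      by (simp_all add: scaleR_left_distrib scaleR_left_diff_distrib)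
    \<comment> \<open>The nodes \<open>u + v\<close> and \<open>u - v\<close> carry no explicit
      scalar, so \<open>shift\<close> does not match them syntactically.\<close>
    have unit_shift [simp]: "u + 12 *\<^sub>R v + v = u + 13 *\<^sub>R v"
      "u + 12 *\<^sub>R v - v = u + 11 *\<^sub>R v"
      using shift[of 1] by simp_all
    \<comment> \<open>Summing over a list lets the simplifier unfold all 26 terms once the interval
      is evaluated.\<close>
    have "(fdiff v ^^ 25) \<sigma> u =
      (\<Sum>k\<leftarrow>[0..<26]. ((-1) ^ (25 + k) * real (25 choose k)) *\<^sub>R \<sigma> (u + real k *\<^sub>R v))"
      unfolding fdiff_funpow_eq_sum interv_sum_list_conv_sum_set_nat
      by (rule sum.cong) auto
    also have "[0..<26] = [0,1,2,3,4,5,6,7,8,9,10,11,12,13,14,15,16,17,18,19,20,21,22,23,24,25]"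
      by code_simp
    also have "sum_list (map (\<lambda>k. ((-1) ^ (25 + k) * real (25 choose k)) *\<^sub>R \<sigma> (u + real k *\<^sub>R v)) \<dots>)
      = fact 25 *\<^sub>R \<sigma> v"
      unfolding assms[of "u + 12 *\<^sub>R v" v, symmetric]
      by (simp add: choose_25)
    finally show "(fdiff v ^^ 25) \<sigma> u = fact 25 *\<^sub>R \<sigma> v" .
  qed
  have "fact 25 *\<^sub>R \<sigma> (v + v) = 2 ^ 25 *\<^sub>R fact 25 *\<^sub>R \<sigma> v"
    using fdiff_funpow_double_step[OF diff[of v]] unfolding diff[of "v + v"] by (rule fun_cong)
  then have "fact 25 *\<^sub>R \<sigma> (v + v) = fact 25 *\<^sub>R 2 ^ 25 *\<^sub>R \<sigma> v"
    by (simp only: scaleR_left_commute)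
  then have "\<sigma> (v + v) = 2 ^ 25 *\<^sub>R \<sigma> v"
    by (simp only: scaleR_cancel_left fact_nonzero simp_thms)
  then show "\<sigma> (2 *\<^sub>R v) = 2 ^ 25 *\<^sub>R \<sigma> v"
    by (simp only: scaleR_2)
qed

end
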